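(* Let $\{B_n(x)\}_{n=0}^\infty$ be a sequence in $\mathbb{R}[x]$ with $\deg(B_n(x))=n$ for every $n\in\mathbb{N}_0$ (and $B_0(x)\not\equiv 0$), let $\{a_n\}_{n=0}^\infty$ be a sequence of real numbers, and let $\{Q_k(x)\}_{k=0}^\infty$ be a sequence in $\mathbb{R}[x]$ such that the linear operator $T=\sum_{k=0}^\infty Q_k(x)D^k:\mathbb{R}[x]\to\mathbb{R}[x]$ satisfies $$T[B_n(x)]=\left(\sum_{k=0}^\infty Q_k(x)D^k\right)B_n(x)=a_nB_n(x)\quad\text{for every } n\in\mathbb{N}_0 .$$ Then, for $m\in\mathbb{N}_0$, the sequence $\{a_n\}_{n=0}^\infty$ can be interpolated by a polynomial of degree $m$ if and only if $\deg(Q_m(x))=m$ and $\deg(Q_k(x))<k$ for every $k>m$. Moreover, $\{a_n\}_{n=0}^\infty$ cannot be interpolated by a polynomial if and only if $\deg(Q_k(x))=k$ for infinitely many $k\in\mathbb{N}_0$.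
   Context: $\mathbb{N}_0=\{0,1,2,\dots\}$ and $D=\frac{d}{dx}$. The operator $\sum_{k=0}^\infty Q_k(x)D^k$ acts on $p\in\mathbb{R}[x]$ by $p\mapsto\sum_{k=0}^{\infty}Q_k(x)p^{(k)}(x)$, a finite sum since $p^{(k)}=0$ for $k>\deg p$. A sequence of real numbers $\{a_n\}_{n=0}^\infty$ is (can be) interpolated by a polynomial $p(x)$ if $a_n=p(n)$ for every $n\in\mathbb{N}_0$; if there is no such polynomial, it cannot be interpolated by a polynomial. Convention: the zero polynomial has degree $-\infty$. *)

theory Defs
  imports "HOL-Computational_Algebra.Polynomial" "HOL-Library.Extended_Real"
begin

(* Degree with the convention that the zero polynomial has degree -\<infinity>;
   the library's degree function gives it degree 0. *)
definition pdeg :: "'a::zero poly \<Rightarrow> ereal" where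
  "pdeg p = (if p = 0 then -\<infinity> else ereal (real (degree p)))"

(* The operator (\<Sum>k. Q k * D^k) applied to p. The terms with k > degree p vanish;
   diff_op_eq_sum shows that the choice of cut-off is immaterial. *)
definition diff_op :: "(nat \<Rightarrow> real poly) \<Rightarrow> real poly \<Rightarrow> real poly" where
  "diff_op Q p = (\<Sum>k\<le>degree p. Q k * (pderiv ^^ k) p)"

definition interpolates :: "real poly \<Rightarrow> (nat \<Rightarrow> real) \<Rightarrow> bool" where
  "interpolates p a \<longleftrightarrow> (\<forall>n. a n = poly p (real n))"

lemma funpow_pderiv_eq_0:
  fixes p :: "real poly"
  assumes "degree p < k"
  shows "(pderiv ^^ k) p = 0"
  using assms
proof (induction k arbitrary: p)
  case 0
  then show ?case by simp
next
  case (Suc k)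
  have z: "(pderiv ^^ j) (0 :: real poly) = 0" for j
    by (induction j) simp_all
  have "(pderiv ^^ k) (pderiv p) = 0"
  proof (cases "degree p = 0")
    case True
    then have "pderiv p = 0" by (simp add: pderiv_eq_0_iff)
    then show ?thesis using z by simp
  next
    case False
    then have "degree (pderiv p) < k" using Suc.prems by (simp add: degree_pderiv)
    then show ?thesis by (rule Suc.IH)
  qed
  then show ?case by (simp add: funpow_swap1)
qed

lemma diff_op_eq_sum:
  assumes "degree p \<le> N"
  shows "diff_op Q p = (\<Sum>k\<le>N. Q k * (pderiv ^^ k) p)"
  unfolding diff_op_def
  by (rule sum.mono_neutral_left) (use assms in \<open>auto simp: funpow_pderiv_eq_0\<close>)

end

theory Submission
  imports Defs
begin

text \<open>
  Write \<open>(x)\<^sub>k = x (x - 1) \<dots> (x - k + 1)\<close> for the falling factorial. Solving \<open>T[B\<^sub>n] = a\<^sub>n B\<^sub>n\<close>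
  for the term \<open>Q\<^sub>n B\<^sub>n\<^sup>(\<^sup>n\<^sup>)\<close>, whose second factor is a nonzero constant, shows inductively that
  \<open>deg Q\<^sub>n \<le> n\<close> (\<open>degree_operator_coeff_le\<close>). So \<open>Q\<^sub>k D\<^sup>k\<close> does not raise degrees, and it
  multiplies the coefficient at \<open>x\<^sup>n\<close> of a polynomial of degree \<open>n\<close> by \<open>q\<^sub>k (n)\<^sub>k\<close>, where \<open>q\<^sub>k\<close> is the
  coefficient of \<open>Q\<^sub>k\<close> at \<open>x\<^sup>k\<close>. Comparing leading coefficients in the eigenvalue equation gives
  \<open>a\<^sub>n = (\<Sum>k\<le>n. q\<^sub>k (n)\<^sub>k)\<close> (\<open>eigenvalue_newton_expansion\<close>).

  This is the Newton expansion of the sequence \<open>a\<close>, and it is triangular: \<open>a\<close> determines \<open>q\<close>.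
  As the polynomials \<open>(x)\<^sub>k\<close> form a basis of the polynomials, \<open>a\<close> is interpolated by a polynomial of
  degree at most \<open>m\<close> exactly if \<open>q\<^sub>k = 0\<close> for all \<open>k > m\<close>, and then \<open>q\<^sub>m\<close> is the coefficient of that
  polynomial at \<open>x\<^sup>m\<close>. Since \<open>deg Q\<^sub>k = k\<close> means \<open>q\<^sub>k \<noteq> 0\<close>, both claims follow.
\<close>

section \<open>Falling factorials and Newton expansions\<close>

definition falling_poly :: "nat \<Rightarrow> 'a::comm_ring_1 poly" where
  "falling_poly k = (\<Prod>i<k. [:- of_nat i, 1:])"

lemma degree_falling_poly [simp]: "degree (falling_poly k :: 'a::idom poly) = k"
  unfolding falling_poly_def by (subst degree_prod_eq_sum_degree) auto

lemma coeff_falling_poly_self [simp]: "coeff (falling_poly k :: 'a::idom poly) k = 1"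
proof -
  have "lead_coeff (falling_poly k :: 'a poly) = 1"
    unfolding falling_poly_def by (simp add: lead_coeff_prod)
  then show ?thesis by simp
qed

lemma poly_falling_poly: "poly (falling_poly k) x = (\<Prod>i<k. x - of_nat i)"
  by (simp add: falling_poly_def poly_prod)

lemma poly_falling_poly_eq_0:
  "n < k \<Longrightarrow> poly (falling_poly k) (of_nat n :: 'a::idom) = 0"
  by (auto simp: poly_falling_poly)

lemma poly_falling_poly_self: "poly (falling_poly k) (of_nat k :: 'a::{idom,ring_char_0}) \<noteq> 0"
  by (auto simp: poly_falling_poly)

text \<open>
  The rising product on the right is the factor by which the \<open>k\<close>-th derivative scales the
  coefficient at \<open>x\<^sup>n\<close>.
\<close>
lemma poly_falling_poly_eq_pochhammer:
  assumes "k \<le> n"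
  shows "poly (falling_poly k) (of_nat n :: 'a::comm_ring_1) = pochhammer (of_nat (Suc (n - k))) k"
proof -
  have "pochhammer (of_nat (Suc (n - k)) :: 'a) k = (\<Prod>i<k. of_nat (Suc (n - k)) + of_nat i)"
    by (simp add: pochhammer_prod atLeast0LessThan)
  also have "\<dots> = (\<Prod>i<k. of_nat (Suc (n - k)) + of_nat (k - Suc i))"
    by (rule prod.nat_diff_reindex [symmetric])
  also have "\<dots> = (\<Prod>i<k. of_nat n - of_nat i)"
  proof (rule prod.cong)
    fix i assume "i \<in> {..<k}"
    then have "Suc (n - k) + (k - Suc i) = n - i" "i \<le> n"
      using assms by auto
    then show "of_nat (Suc (n - k)) + of_nat (k - Suc i) = (of_nat n - of_nat i :: 'a)"
      by (metis of_nat_add of_nat_diff)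
  qed simp
  finally show ?thesis by (simp add: poly_falling_poly)
qed

definition newton_poly :: "(nat \<Rightarrow> 'a::comm_ring_1) \<Rightarrow> nat \<Rightarrow> 'a poly" where
  "newton_poly q m = (\<Sum>k\<le>m. smult (q k) (falling_poly k))"

lemma degree_newton_poly_le: "degree (newton_poly q m :: 'a::idom poly) \<le> m"
  unfolding newton_poly_def
  by (rule degree_sum_le) (auto intro: order_trans [OF degree_smult_le])

lemma coeff_newton_poly_self: "coeff (newton_poly q m :: 'a::idom poly) m = q m"
proof -
  have "coeff (newton_poly q m) m = (\<Sum>k\<le>m. if k = m then q m else 0)"
    unfolding newton_poly_def coeff_sum
    by (rule sum.cong) (auto intro: coeff_eq_0)
  then show ?thesis by simp
qed

lemma poly_newton_poly: "poly (newton_poly q m) x = (\<Sum>k\<le>m. q k * poly (falling_poly k) x)"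
  by (simp add: newton_poly_def poly_sum)

text \<open>
  The falling factorials are monic, one in each degree, so the top coefficient can be
  removed repeatedly by subtracting a multiple of one of them.
\<close>
lemma newton_poly_exists:
  fixes p :: "'a::idom poly"
  assumes "degree p \<le> m"
  shows "\<exists>b. p = newton_poly b m"
  using assms
proof (induction m arbitrary: p)
  case 0
  then obtain c where "p = [:c:]"
    by (auto elim: degree_eq_zeroE)
  then have "p = newton_poly (\<lambda>_. c) 0"
    by (simp add: newton_poly_def falling_poly_def)
  then show ?case by blast
next
  case (Suc m)
  define c where "c = coeff p (Suc m)"
  define r where "r = p - smult c (falling_poly (Suc m))"
  have "degree r \<le> m"
  proof (rule degree_le, intro allI impI)
    fix i assume "m < i"
    show "coeff r i = 0"
    proof (cases "i = Suc m")
      case True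
      then show ?thesis by (simp add: r_def c_def)
    next
      case False
      with \<open>m < i\<close> Suc.prems show ?thesis by (simp add: r_def coeff_eq_0)
    qed
  qed
  then obtain b where b: "r = newton_poly b m" using Suc.IH by blast
  have "p = newton_poly (b(Suc m := c)) (Suc m)"
    using b by (simp add: r_def newton_poly_def algebra_simps)
  then show ?case by blast
qed

text \<open>
  The system is triangular with nonzero diagonal entries, since \<open>(n)\<^sub>k\<close> vanishes for \<open>k > n\<close> but
  not for \<open>k = n\<close>.
\<close>
lemma newton_coefficients_unique:
  fixes q b :: "nat \<Rightarrow> 'a::{idom,ring_char_0}"
  assumes "\<And>n. (\<Sum>k\<le>n. q k * poly (falling_poly k) (of_nat n)) =
                (\<Sum>k\<le>n. b k * poly (falling_poly k) (of_nat n))"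
  shows "q = b"
proof
  fix n
  show "q n = b n"
  proof (induction n rule: less_induct)
    case (less n)
    then have "(\<Sum>k<n. q k * poly (falling_poly k) (of_nat n)) =
               (\<Sum>k<n. b k * poly (falling_poly k) (of_nat n))"
      by (intro sum.cong) auto
    with assms [of n] show ?case
      by (simp add: lessThan_Suc_atMost [symmetric] poly_falling_poly_self)
  qed
qed

text \<open>
  The upper summation limit \<open>n\<close> may be replaced by any bound for the support of the
  coefficients, as the terms with \<open>k > n\<close> vanish at \<open>n\<close>.
\<close>
lemma poly_newton_poly_of_nat:
  fixes q :: "nat \<Rightarrow> 'a::idom"
  assumes "\<forall>k>m. q k = 0"
  shows "poly (newton_poly q m) (of_nat n) = (\<Sum>k\<le>n. q k * poly (falling_poly k) (of_nat n))"
proof -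
  have "(\<Sum>k\<le>m. q k * poly (falling_poly k) (of_nat n)) =
        (\<Sum>k\<le>max m n. q k * poly (falling_poly k) (of_nat n))"
    by (rule sum.mono_neutral_left) (use assms in auto)
  also have "\<dots> = (\<Sum>k\<le>n. q k * poly (falling_poly k) (of_nat n))"
    by (rule sum.mono_neutral_right) (auto simp: poly_falling_poly_eq_0)
  finally show ?thesis by (simp add: poly_newton_poly)
qed

lemma interpolates_degree_le_iff:
  fixes a q :: "nat \<Rightarrow> real"
  assumes a: "\<And>n. a n = (\<Sum>k\<le>n. q k * poly (falling_poly k) (real n))"
  shows "interpolates p a \<and> degree p \<le> m \<longleftrightarrow> (\<forall>k>m. q k = 0) \<and> p = newton_poly q m"
proof
  assume p: "interpolates p a \<and> degree p \<le> m"
  then obtain b where b: "p = newton_poly b m" using newton_poly_exists by blast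
  define b' where "b' = (\<lambda>k. if k \<le> m then b k else 0)"
  have b': "p = newton_poly b' m" "\<forall>k>m. b' k = 0"
    by (simp_all add: b b'_def newton_poly_def)
  have "q = b'"
  proof (rule newton_coefficients_unique)
    fix n
    have "a n = poly (newton_poly b' m) (real n)"
      using p b'(1) by (simp add: interpolates_def)
    then show "(\<Sum>k\<le>n. q k * poly (falling_poly k) (real n)) =
               (\<Sum>k\<le>n. b' k * poly (falling_poly k) (real n))"
      using a poly_newton_poly_of_nat [OF b'(2)] by simp
  qed
  with b' show "(\<forall>k>m. q k = 0) \<and> p = newton_poly q m" by simp
next
  assume q: "(\<forall>k>m. q k = 0) \<and> p = newton_poly q m"
  then have "poly p (real n) = a n" for n
    using poly_newton_poly_of_nat [of m q n] a by simp
  with q show "interpolates p a \<and> degree p \<le> m"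
    by (simp add: interpolates_def degree_newton_poly_le)
qed

section \<open>Operators with a polynomial eigenbasis\<close>

lemma degree_funpow_pderiv_le:
  fixes p :: "real poly"
  shows "degree ((pderiv ^^ k) p) \<le> degree p - k"
  by (rule degree_le) (auto simp: coeff_higher_pderiv intro: coeff_eq_0)

text \<open>
  In the eigenvalue equation for \<open>B\<^sub>k\<close>, the polynomial \<open>Q\<^sub>k\<close> is multiplied by the nonzero constant
  \<open>B\<^sub>k\<^sup>(\<^sup>k\<^sup>)\<close>; all other terms have degree at most \<open>k\<close> by induction.
\<close>
lemma degree_operator_coeff_le:
  fixes B Q :: "nat \<Rightarrow> real poly"
  assumes deg: "\<And>n. degree (B n) = n" and nz: "\<And>n. B n \<noteq> 0"
    and eig: "\<And>n. diff_op Q (B n) = smult (a n) (B n)"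
  shows "degree (Q k) \<le> k"
proof (induction k rule: less_induct)
  case (less k)
  let ?S = "\<Sum>j<k. Q j * (pderiv ^^ j) (B k)"
  let ?C = "(pderiv ^^ k) (B k)"
  have "degree ?C = 0"
    using degree_funpow_pderiv_le [of k "B k"] deg by simp
  moreover have "coeff ?C 0 \<noteq> 0"
    using nz [of k] leading_coeff_0_iff [of "B k"] deg [of k]
    by (simp add: coeff_higher_pderiv pochhammer_eq_0_iff)
  ultimately obtain c where c: "?C = [:c:]" "c \<noteq> 0"
    by (metis coeff_pCons_0 degree_eq_zeroE)
  have "degree ?S \<le> k"
  proof (rule degree_sum_le)
    fix j assume "j \<in> {..<k}"
    then have "degree (Q j) + degree ((pderiv ^^ j) (B k)) \<le> j + (k - j)"
      using less degree_funpow_pderiv_le [of j "B k"] deg by (intro add_mono) auto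
    with \<open>j \<in> {..<k}\<close> show "degree (Q j * (pderiv ^^ j) (B k)) \<le> k"
      using degree_mult_le [of "Q j" "(pderiv ^^ j) (B k)"] by simp
  qed simp
  moreover have "smult c (Q k) = smult (a k) (B k) - ?S"
    using eig [of k] c by (simp add: diff_op_def deg lessThan_Suc_atMost [symmetric] algebra_simps)
  moreover have "degree (smult (a k) (B k)) \<le> k"
    using degree_smult_le [of "a k" "B k"] deg by simp
  ultimately have "degree (smult c (Q k)) \<le> k"
    by (simp add: degree_diff_le)
  with c show ?case by simp
qed

lemma coeff_mult_degree_bounds:
  fixes p q :: "'a::comm_semiring_0 poly"
  assumes "degree p \<le> i" and "degree q \<le> j"
  shows "coeff (p * q) (i + j) = coeff p i * coeff q j"
proof -
  have "coeff p l * coeff q (i + j - l) = (if l = i then coeff p i * coeff q j else 0)" for l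
  proof (cases l i rule: linorder_cases)
    case less
    then have "coeff q (i + j - l) = 0" using assms by (intro coeff_eq_0) auto
    with less show ?thesis by simp
  next
    case greater
    then have "coeff p l = 0" using assms by (intro coeff_eq_0) auto
    with greater show ?thesis by simp
  qed simp
  then show ?thesis by (simp add: coeff_mult)
qed

text \<open>Comparison of the coefficients at \<open>x\<^sup>n\<close> on the two sides of \<open>T[B\<^sub>n] = a\<^sub>n B\<^sub>n\<close>.\<close>
lemma eigenvalue_newton_expansion:
  fixes B Q :: "nat \<Rightarrow> real poly"
  assumes deg: "\<And>n. degree (B n) = n" and nz: "\<And>n. B n \<noteq> 0"
    and eig: "\<And>n. diff_op Q (B n) = smult (a n) (B n)"
  shows "a n = (\<Sum>k\<le>n. coeff (Q k) k * poly (falling_poly k) (real n))"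
proof -
  have "coeff (Q k * (pderiv ^^ k) (B n)) n =
        coeff (Q k) k * poly (falling_poly k) (real n) * coeff (B n) n" if "k \<le> n" for k
  proof -
    have "coeff (Q k * (pderiv ^^ k) (B n)) (k + (n - k)) =
          coeff (Q k) k * coeff ((pderiv ^^ k) (B n)) (n - k)"
    proof (rule coeff_mult_degree_bounds)
      show "degree (Q k) \<le> k" using assms by (rule degree_operator_coeff_le)
      show "degree ((pderiv ^^ k) (B n)) \<le> n - k"
        using degree_funpow_pderiv_le [of k "B n"] deg by simp
    qed
    with that show ?thesis
      by (simp add: coeff_higher_pderiv poly_falling_poly_eq_pochhammer del: of_nat_Suc)
  qed
  then have "coeff (diff_op Q (B n)) n =
      (\<Sum>k\<le>n. coeff (Q k) k * poly (falling_poly k) (real n)) * coeff (B n) n"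
    by (simp add: diff_op_def deg coeff_sum sum_distrib_right)
  moreover have "coeff (B n) n \<noteq> 0"
    using nz [of n] leading_coeff_0_iff [of "B n"] deg [of n] by simp
  ultimately show ?thesis using eig [of n] by simp
qed

lemma pdeg_eq_iff: "pdeg p = ereal (real n) \<longleftrightarrow> degree p \<le> n \<and> coeff p n \<noteq> 0"
  by (cases "p = 0") (auto simp: pdeg_def le_antisym le_degree)

lemma pdeg_less_iff: "degree p \<le> n \<Longrightarrow> pdeg p < ereal (real n) \<longleftrightarrow> coeff p n = 0"
  using pdeg_eq_iff [of p n] by (auto simp: pdeg_def)

theorem theorem8:
  fixes B :: "nat \<Rightarrow> real poly" and a :: "nat \<Rightarrow> real" and Q :: "nat \<Rightarrow> real poly"
  assumes "\<forall>n. pdeg (B n) = ereal (real n)"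
    and "\<forall>n. diff_op Q (B n) = smult (a n) (B n)"
  shows "(\<forall>m::nat. (\<exists>p. interpolates p a \<and> pdeg p = ereal (real m)) \<longleftrightarrow>
             (pdeg (Q m) = ereal (real m) \<and> (\<forall>k>m. pdeg (Q k) < ereal (real k))))
       \<and> ((\<nexists>p. interpolates p a) \<longleftrightarrow> infinite {k::nat. pdeg (Q k) = ereal (real k)})"
proof -
  define q where "q = (\<lambda>k. coeff (Q k) k)"
  have nz: "B n \<noteq> 0" and deg: "degree (B n) = n" for n
    using assms(1) [rule_format, of n] by (auto simp: pdeg_def split: if_splits)
  note eig = assms(2) [rule_format]
  have degQ: "degree (Q k) \<le> k" for k
    using deg nz eig by (rule degree_operator_coeff_le)
  have a: "a n = (\<Sum>k\<le>n. q k * poly (falling_poly k) (real n))" for n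
    unfolding q_def using deg nz eig by (rule eigenvalue_newton_expansion)
  note interp = interpolates_degree_le_iff [of a q, OF a]
  have Q_eq: "pdeg (Q k) = ereal (real k) \<longleftrightarrow> q k \<noteq> 0"
    and Q_less: "pdeg (Q k) < ereal (real k) \<longleftrightarrow> q k = 0" for k
    using degQ [of k] by (simp_all add: pdeg_eq_iff pdeg_less_iff q_def)

  have "(\<exists>p. interpolates p a \<and> pdeg p = ereal (real m)) \<longleftrightarrow> q m \<noteq> 0 \<and> (\<forall>k>m. q k = 0)" for m
    using interp [of _ m] coeff_newton_poly_self [of q m] unfolding pdeg_eq_iff by metis
  moreover have "(\<exists>p. interpolates p a) \<longleftrightarrow> (\<exists>m. \<forall>k>m. q k = 0)"
    using interp by blast
  moreover have "(\<exists>m. \<forall>k>m. q k = 0) \<longleftrightarrow> finite {k. q k \<noteq> 0}"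
    by (auto simp: finite_nat_set_iff_bounded_le linorder_not_less [symmetric])
  ultimately show ?thesis
    unfolding Q_eq Q_less by simp
qed

end
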